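(* Let $X$ be a quasisober space and let $p:X\to X$ be a continuous map that is a kernel operator with respect to the specialization order of $X$. Then $p(X)$, with the subspace topology from $X$, is quasisober.
   Context: For a topological space $X$, the specialization preorder is $x\le y$ iff $x\in\mathrm{cl}\{y\}$; all order-theoretic notions in $X$ refer to it (for a subspace, to the specialization preorder of the subspace, with bounds taken inside the subspace). For $A\subseteq X$, $A^{\uparrow}$ and $A^{\downarrow}$ denote the sets of all upper, respectively lower, bounds of $A$ in $X$, and $A^{\delta}=(A^{\uparrow})^{\downarrow}$ is the cut closure of $A$. Directed sets and irreducible closed sets are nonempty. $X$ is quasisober if it is $T_0$ and every irreducible closed subset of $X$ equals $D^{\delta}$ for some directed subset $D$ of $X$. A kernel operator is a monotone idempotent self-map $p$ (so $p\circ p=p$) with $p(x)\le x$ for all $x$. *)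

theory Defs
  imports "HOL-Analysis.Analysis"
begin

definition spec_le :: "'a topology \<Rightarrow> 'a \<Rightarrow> 'a \<Rightarrow> bool" where
  "spec_le X x y \<longleftrightarrow> x \<in> topspace X \<and> y \<in> topspace X \<and> x \<in> X closure_of {y}"

definition upper_bounds :: "'a topology \<Rightarrow> 'a set \<Rightarrow> 'a set" where
  "upper_bounds X A = {u \<in> topspace X. \<forall>a\<in>A. spec_le X a u}"

definition lower_bounds :: "'a topology \<Rightarrow> 'a set \<Rightarrow> 'a set" where
  "lower_bounds X A = {l \<in> topspace X. \<forall>a\<in>A. spec_le X l a}"

definition cut_closure :: "'a topology \<Rightarrow> 'a set \<Rightarrow> 'a set" where
  "cut_closure X A = lower_bounds X (upper_bounds X A)"

definition directed_in :: "'a topology \<Rightarrow> 'a set \<Rightarrow> bool" where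
  "directed_in X D \<longleftrightarrow>
     D \<subseteq> topspace X \<and> D \<noteq> {} \<and> (\<forall>x\<in>D. \<forall>y\<in>D. \<exists>z\<in>D. spec_le X x z \<and> spec_le X y z)"

definition irreducible_closedin :: "'a topology \<Rightarrow> 'a set \<Rightarrow> bool" where
  "irreducible_closedin X C \<longleftrightarrow>
     closedin X C \<and> C \<noteq> {} \<and>
     (\<forall>A B. closedin X A \<and> closedin X B \<and> C \<subseteq> A \<union> B \<longrightarrow> C \<subseteq> A \<or> C \<subseteq> B)"

definition quasisober :: "'a topology \<Rightarrow> bool" where
  "quasisober X \<longleftrightarrow>
     t0_space X \<and>
     (\<forall>C. irreducible_closedin X C \<longrightarrow> (\<exists>D. directed_in X D \<and> C = cut_closure X D))"

definition kernel_operator :: "'a topology \<Rightarrow> ('a \<Rightarrow> 'a) \<Rightarrow> bool" where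
  "kernel_operator X p \<longleftrightarrow>
     p \<in> topspace X \<rightarrow> topspace X \<and>
     monotone_on (topspace X) (spec_le X) (spec_le X) p \<and>
     (\<forall>x\<in>topspace X. p (p x) = p x) \<and>
     (\<forall>x\<in>topspace X. spec_le X (p x) x)"

end

theory Submission
  imports Defs
begin

text \<open>
  In a quasisober space \<open>cut_closure X D = X closure_of D\<close> for every directed \<open>D\<close>: the closure of \<open>D\<close>
  is irreducible, hence a cut closure, and cut closures absorb the cut closures of their subsets.
  Let \<open>Y\<close> be the image of \<open>p\<close>, \<open>C\<close> irreducible closed in \<open>Y\<close>, and let \<open>D\<close> be a directed set whose
  cut closure is the closure of \<open>C\<close> in \<open>X\<close>. Then \<open>C\<close> is the cut closure of \<open>p ` D\<close> in \<open>Y\<close>.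
  If \<open>u \<in> Y\<close> bounds \<open>p ` D\<close>, the closed set of all \<open>x\<close> with \<open>p x \<le> u\<close> contains \<open>D\<close>, hence its closure,
  hence \<open>C\<close>, whose points are fixed by \<open>p\<close>. Conversely, \<open>p v\<close> bounds \<open>p ` D\<close> in \<open>Y\<close> whenever
  \<open>v\<close> bounds \<open>D\<close> in \<open>X\<close>, and \<open>p v \<le> v\<close>.
\<close>

text \<open>The closure of \<open>{y}\<close> is the smallest closed set containing
  \<open>y\<close>. In this form closed sets are visibly lower sets and transitivity is
  immediate.\<close>

lemma spec_le_iff:
  "spec_le X x y \<longleftrightarrow>
    x \<in> topspace X \<and> y \<in> topspace X \<and> (\<forall>A. closedin X A \<and> y \<in> A \<longrightarrow> x \<in> A)"
proof
  assume "spec_le X x y"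
  then show "x \<in> topspace X \<and> y \<in> topspace X \<and> (\<forall>A. closedin X A \<and> y \<in> A \<longrightarrow> x \<in> A)"
    unfolding spec_le_def
    by (metis bot.extremum closure_of_minimal insert_subset subsetD)
next
  assume R: "x \<in> topspace X \<and> y \<in> topspace X \<and> (\<forall>A. closedin X A \<and> y \<in> A \<longrightarrow> x \<in> A)"
  then have "y \<in> X closure_of {y}"
    by (meson closure_of_subset empty_subsetI insert_subset singletonI subsetD)
  with R show "spec_le X x y"
    unfolding spec_le_def using closedin_closure_of by blast
qed

lemma spec_le_trans: "spec_le X x y \<Longrightarrow> spec_le X y z \<Longrightarrow> spec_le X x z"
  by (simp add: spec_le_iff)

lemma spec_le_subtopology:
  assumes "Y \<subseteq> topspace X"
  shows "spec_le (subtopology X Y) x y \<longleftrightarrow> x \<in> Y \<and> y \<in> Y \<and> spec_le X x y"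
  using assms by (auto simp: spec_le_def closure_of_subtopology Int_absorb1)

text \<open>The set is the closure of \<open>{u}\<close>, or empty when \<open>u\<close> is not a
  point of \<open>X\<close>.\<close>

lemma closedin_principal_ideal: "closedin X {x. spec_le X x u}"
proof (cases "u \<in> topspace X")
  case True
  then have "{x. spec_le X x u} = X closure_of {u}"
    using closure_of_subset_topspace[of X "{u}"] by (auto simp: spec_le_def)
  then show ?thesis
    by simp
qed (simp add: spec_le_def)

text \<open>Every upper bound of \<open>E\<close> also bounds \<open>D\<close>, and passing to lower
  bounds reverses inclusions.\<close>

lemma cut_closure_least:
  assumes "D \<subseteq> cut_closure X E"
  shows "cut_closure X D \<subseteq> cut_closure X E"
proof -
  have "upper_bounds X E \<subseteq> upper_bounds X D"
    using assms by (auto simp: cut_closure_def lower_bounds_def upper_bounds_def)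
  then show ?thesis
    by (auto simp: cut_closure_def lower_bounds_def)
qed

text \<open>If \<open>D\<close> had a point outside \<open>A\<close> and one outside
  \<open>B\<close>, an upper bound of both in \<open>D\<close> would avoid \<open>A\<close> and
  \<open>B\<close>, since closed sets are lower sets.\<close>

lemma irreducible_closedin_closure_of_directed:
  assumes "directed_in X D"
  shows "irreducible_closedin X (X closure_of D)"
  unfolding irreducible_closedin_def
proof (intro conjI allI impI)
  have D: "D \<subseteq> X closure_of D" "D \<noteq> {}"
    using assms by (auto simp: directed_in_def closure_of_subset)
  then show "X closure_of D \<noteq> {}"
    by blast
  fix A B
  assume AB: "closedin X A \<and> closedin X B \<and> X closure_of D \<subseteq> A \<union> B"
  have "D \<subseteq> A \<or> D \<subseteq> B"
  proof (rule ccontr)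
    assume "\<not> (D \<subseteq> A \<or> D \<subseteq> B)"
    then obtain a b where "a \<in> D" "a \<notin> A" "b \<in> D" "b \<notin> B"
      by blast
    moreover from this obtain z where "z \<in> D" "spec_le X a z" "spec_le X b z"
      using assms unfolding directed_in_def by blast
    moreover from this have "z \<in> A \<or> z \<in> B"
      using AB D by blast
    ultimately show False
      using AB by (metis spec_le_iff)
  qed
  then show "X closure_of D \<subseteq> A \<or> X closure_of D \<subseteq> B"
    using AB closure_of_minimal by metis
qed simp

text \<open>A closed cover in \<open>X\<close> restricts to a cover of \<open>C\<close> closed in
  the subspace; whichever closed set contains \<open>C\<close> also contains its closure.\<close>

lemma irreducible_closedin_closure_of_subtopology:
  assumes "irreducible_closedin (subtopology X Y) C"
  shows "irreducible_closedin X (X closure_of C)"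
  unfolding irreducible_closedin_def
proof (intro conjI allI impI)
  have C: "C \<subseteq> topspace X" "C \<subseteq> Y" "C \<noteq> {}"
    using assms closedin_subset[of "subtopology X Y" C]
    by (auto simp: irreducible_closedin_def)
  then have sub: "C \<subseteq> X closure_of C"
    by (simp add: closure_of_subset)
  with C show "X closure_of C \<noteq> {}"
    by blast
  fix A B
  assume AB: "closedin X A \<and> closedin X B \<and> X closure_of C \<subseteq> A \<union> B"
  then have "closedin (subtopology X Y) (A \<inter> Y)" "closedin (subtopology X Y) (B \<inter> Y)"
    by (auto simp: closedin_subtopology)
  moreover have "C \<subseteq> (A \<inter> Y) \<union> (B \<inter> Y)"
    using AB sub C by blast
  ultimately have "C \<subseteq> A \<inter> Y \<or> C \<subseteq> B \<inter> Y"
    using assms unfolding irreducible_closedin_def by blast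
  then show "X closure_of C \<subseteq> A \<or> X closure_of C \<subseteq> B"
    using AB by (metis closure_of_minimal le_infE)
qed simp

lemma quasisober_cut_closure_subset_closure_of:
  assumes "quasisober X" "directed_in X D"
  shows "cut_closure X D \<subseteq> X closure_of D"
proof -
  obtain E where "X closure_of D = cut_closure X E"
    using assms irreducible_closedin_closure_of_directed unfolding quasisober_def by blast
  moreover have "D \<subseteq> X closure_of D"
    using assms(2) by (simp add: directed_in_def closure_of_subset)
  ultimately show ?thesis
    using cut_closure_least by metis
qed

theorem proposition3p11:
  fixes X :: "'a topology" and p :: "'a \<Rightarrow> 'a"
  assumes "quasisober X"
    and "continuous_map X X p"
    and "kernel_operator X p"
  shows "quasisober (subtopology X (p ` topspace X))"
proof -
  define Y where "Y = p ` topspace X"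
  let ?Y = "subtopology X Y"
  have YX: "Y \<subseteq> topspace X"
    using assms(3) by (auto simp: kernel_operator_def Y_def)
  have fix_p: "p y = y" if "y \<in> Y" for y
    using assms(3) that by (auto simp: kernel_operator_def Y_def)
  have p_le: "spec_le X (p x) x" if "x \<in> topspace X" for x
    using assms(3) that by (auto simp: kernel_operator_def)
  have p_mono: "spec_le X (p x) (p y)" if "spec_le X x y" for x y
    using assms(3) that unfolding kernel_operator_def
    by (metis monotone_onD spec_le_def)
  have leY: "spec_le ?Y x y \<longleftrightarrow> x \<in> Y \<and> y \<in> Y \<and> spec_le X x y" for x y
    by (rule spec_le_subtopology[OF YX])
  have topY: "topspace ?Y = Y"
    using YX by auto
  have "\<exists>D. directed_in ?Y D \<and> C = cut_closure ?Y D" if C: "irreducible_closedin ?Y C" for C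
  proof -
    have closed_C: "closedin ?Y C"
      using C by (simp add: irreducible_closedin_def)
    then have CY: "C \<subseteq> Y"
      using closedin_subset topY by metis
    \<comment> \<open>Closures in a subspace are traces of closures in \<open>X\<close>.\<close>
    have C_eq: "C = Y \<inter> X closure_of C"
      using closed_C CY
      by (metis closure_of_closedin closure_of_subtopology inf.absorb2)
    obtain D where D: "directed_in X D" "X closure_of C = cut_closure X D"
      using assms(1) irreducible_closedin_closure_of_subtopology[OF C]
      unfolding quasisober_def by blast
    have DX: "D \<subseteq> topspace X"
      using D(1) by (simp add: directed_in_def)
    have pD: "p ` D \<subseteq> Y"
      using DX by (auto simp: Y_def)
    have "directed_in ?Y (p ` D)"
      unfolding directed_in_def topY
    proof (intro conjI ballI pD)
      show "p ` D \<noteq> {}"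
        using D(1) by (simp add: directed_in_def)
      fix x y
      assume "x \<in> p ` D" "y \<in> p ` D"
      then obtain a b where ab: "a \<in> D" "b \<in> D" "x = p a" "y = p b"
        by blast
      then obtain z where "z \<in> D" "spec_le X a z" "spec_le X b z"
        using D(1) unfolding directed_in_def by blast
      then show "\<exists>z\<in>p ` D. spec_le ?Y x z \<and> spec_le ?Y y z"
        using ab pD p_mono unfolding leY by blast
    qed
    moreover have "C \<subseteq> cut_closure ?Y (p ` D)"
    proof
      fix c
      assume "c \<in> C"
      have "spec_le X c u" if u: "u \<in> upper_bounds ?Y (p ` D)" for u
      proof -
        \<comment> \<open>Continuity of \<open>p\<close> enters here: \<open>?A\<close> is the
          preimage of a closed principal ideal.\<close>
        let ?A = "{x \<in> topspace X. p x \<in> {x. spec_le X x u}}"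
        have "closedin X ?A"
          using assms(2) closedin_principal_ideal by (rule closedin_continuous_map_preimage)
        moreover have "D \<subseteq> ?A"
          using u DX by (auto simp: upper_bounds_def leY)
        ultimately have "X closure_of D \<subseteq> ?A"
          by (simp add: closure_of_minimal)
        moreover have "c \<in> X closure_of D"
          using \<open>c \<in> C\<close> C_eq D quasisober_cut_closure_subset_closure_of[OF assms(1)] by blast
        ultimately have "spec_le X (p c) u"
          by blast
        then show ?thesis
          using fix_p[of c] \<open>c \<in> C\<close> CY by auto
      qed
      then show "c \<in> cut_closure ?Y (p ` D)"
        using \<open>c \<in> C\<close> CY topY
        by (auto simp: cut_closure_def lower_bounds_def leY upper_bounds_def)
    qed
    moreover have "cut_closure ?Y (p ` D) \<subseteq> C"
    proof
      fix y
      assume y: "y \<in> cut_closure ?Y (p ` D)"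
      then have "y \<in> Y"
        using topY by (auto simp: cut_closure_def lower_bounds_def)
      have "spec_le X y v" if v: "v \<in> upper_bounds X D" for v
      proof -
        have vX: "v \<in> topspace X"
          using v by (simp add: upper_bounds_def)
        \<comment> \<open>The bound \<open>v\<close> may lie outside \<open>Y\<close>, so
          \<open>p v\<close> replaces it.\<close>
        then have "p v \<in> Y"
          by (simp add: Y_def)
        moreover have "\<forall>d\<in>D. spec_le X (p d) (p v)"
          using v p_mono by (auto simp: upper_bounds_def)
        ultimately have "p v \<in> upper_bounds ?Y (p ` D)"
          using pD topY by (auto simp: upper_bounds_def leY)
        then have "spec_le X y (p v)"
          using y by (auto simp: cut_closure_def lower_bounds_def leY)
        then show ?thesis
          using p_le[OF vX] spec_le_trans by metis
      qed
      then have "y \<in> cut_closure X D"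
        using \<open>y \<in> Y\<close> YX by (auto simp: cut_closure_def lower_bounds_def)
      then show "y \<in> C"
        using D(2) C_eq \<open>y \<in> Y\<close> by blast
    qed
    ultimately show ?thesis
      by blast
  qed
  moreover have "t0_space ?Y"
    using assms(1) by (simp add: quasisober_def t0_space_subtopology)
  ultimately show ?thesis
    unfolding quasisober_def Y_def by blast
qed

end
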